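(* Let $L$ be a finite-dimensional Lie algebra over a field $F$. Then, for every $x\in L$, the set $\mathrm{sol}_L(x)$ is a disjoint union of some cosets of $Fx$. More precisely, for every $a\in\mathrm{sol}_L(x)$ one has $a+Fx\subseteq \mathrm{sol}_L(x)$, and hence \[\mathrm{sol}_L(x)=\bigsqcup_{a\in\mathcal{R}}(a+Fx)\] for some set $\mathcal{R}\subseteq\mathrm{sol}_L(x)$ of representatives of the cosets of $Fx$ contained in $\mathrm{sol}_L(x)$.
   Context: For elements $x,y$ of a Lie algebra $L$, $\langle x,y\rangle$ denotes the Lie subalgebra generated by $x$ and $y$. For $x\in L$, the solvabilizer of $x$ in $L$ is $\mathrm{sol}_L(x)=\{y\in L\mid \langle x,y\rangle \text{ is solvable}\}$. $Fx$ is the linear span of $x$; cosets are taken in the additive group of $L$. *)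

theory Defs
  imports Complex_Main "HOL-Library.Set_Algebras" "HOL-Library.Disjoint_Sets"
begin

locale lie_algebra = vector_space scale
  for scale :: "'f::field \<Rightarrow> 'l::ab_group_add \<Rightarrow> 'l" (infixr \<open>*s\<close> 75) +
  fixes bracket :: "'l \<Rightarrow> 'l \<Rightarrow> 'l"
  assumes bracket_add_left: "bracket (x + y) z = bracket x z + bracket y z"
    and bracket_add_right: "bracket x (y + z) = bracket x y + bracket x z"
    and bracket_scale_left: "bracket (c *s x) y = c *s bracket x y"
    and bracket_scale_right: "bracket x (c *s y) = c *s bracket x y"
    and bracket_self: "bracket x x = 0"
    and jacobi: "bracket x (bracket y z) + bracket y (bracket z x) + bracket z (bracket x y) = 0"
begin

definition subalgebra :: "'l set \<Rightarrow> bool" where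
  "subalgebra H \<longleftrightarrow> subspace H \<and> (\<forall>x\<in>H. \<forall>y\<in>H. bracket x y \<in> H)"

definition generated :: "'l set \<Rightarrow> 'l set" where
  "generated S = subalgebra hull S"

definition derived :: "'l set \<Rightarrow> 'l set" where
  "derived H = span {bracket x y | x y. x \<in> H \<and> y \<in> H}"

text \<open>For a subalgebra \<open>H\<close>, the iterates of \<open>derived\<close> on \<open>H\<close> are the derived series of \<open>H\<close>
  as a Lie algebra in its own right, since spans of subsets of \<open>H\<close> stay in \<open>H\<close>.\<close>

definition solvable :: "'l set \<Rightarrow> bool" where
  "solvable H \<longleftrightarrow> (\<exists>n. (derived ^^ n) H = {0})"

definition solvabilizer :: "'l \<Rightarrow> 'l set" where
  "solvabilizer x = {y. solvable (generated {x, y})}"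

end

locale fin_dim_lie_algebra = lie_algebra +
  assumes finite_spanning_set: "\<exists>B. finite B \<and> span B = UNIV"

end

theory Submission
  imports Defs
begin

text \<open>A subalgebra containing \<open>x\<close> contains \<open>a + c *s x\<close> exactly when
  it contains \<open>a\<close>, so the pairs \<open>{x, a}\<close> and
  \<open>{x, a + c *s x}\<close> generate the same subalgebra, and one is solvable iff the other is.
  Hence the solvabilizer is stable under translation by \<open>span {x}\<close>
  (\<open>solvabilizer_add_span\<close>). The rest is pure coset theory: a set stable under
  translation by a subspace is a union of its cosets, and choosing one point in each gives the
  representatives (\<open>saturated_disjoint_union_of_cosets\<close>).\<close>

context vector_space
begin

lemma coset_eq_iff:
  assumes "subspace U"
  shows "a +o U = b +o U \<longleftrightarrow> a \<in> b +o U"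
proof
  assume "a +o U = b +o U"
  moreover have "a \<in> a +o U"
    using subspace_0[OF assms] by (force simp: elt_set_plus_def)
  ultimately show "a \<in> b +o U" by simp
next
  assume "a \<in> b +o U"
  then obtain u where u: "u \<in> U" "a = b + u" by (auto simp: elt_set_plus_def)
  have "\<exists>w\<in>U. b + u + v = b + w" if "v \<in> U" for v
    using that u(1) subspace_add[OF assms] by (intro bexI[of _ "u + v"]) (auto simp: add.assoc)
  moreover have "\<exists>w\<in>U. b + v = b + u + w" if "v \<in> U" for v
    using that u(1) subspace_diff[OF assms] by (intro bexI[of _ "v - u"]) auto
  ultimately show "a +o U = b +o U"
    using u(2) by (auto simp: elt_set_plus_def)
qed

lemma saturated_disjoint_union_of_cosets:
  assumes U: "subspace U" and sat: "\<And>a. a \<in> S \<Longrightarrow> a +o U \<subseteq> S"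
  shows "\<exists>R\<subseteq>S. (\<forall>c. c +o U \<subseteq> S \<longrightarrow> (\<exists>!a. a \<in> R \<and> a \<in> c +o U)) \<and>
    disjoint_family_on (\<lambda>a. a +o U) R \<and> S = (\<Union>a\<in>R. a +o U)"
proof -
  \<comment> \<open>The choice depends on the coset as a set, not on a point in it, so equal cosets
    get the same representative.\<close>
  define rep where "rep C = (SOME a. a \<in> C)" for C :: "'b set"
  define R where "R = (\<lambda>a. rep (a +o U)) ` S"
  have self: "a \<in> a +o U" for a
    using coset_eq_iff[OF U] by blast
  have rep: "rep (a +o U) \<in> a +o U" for a
    unfolding rep_def using self by (rule someI)
  \<comment> \<open>An element of \<open>R\<close> is thus recovered from its coset; both the
    uniqueness of representatives and disjointness rest on this.\<close>
  have R_rep: "rep (a +o U) = a" if "a \<in> R" for a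
  proof -
    obtain s where s: "a = rep (s +o U)" using \<open>a \<in> R\<close> unfolding R_def by blast
    then have "a +o U = s +o U" using rep coset_eq_iff[OF U] by simp
    with s show ?thesis by simp
  qed
  have R_sub: "R \<subseteq> S"
    using rep sat unfolding R_def by blast
  have "\<exists>!a. a \<in> R \<and> a \<in> c +o U" if "c +o U \<subseteq> S" for c
  proof (rule ex1I)
    show "rep (c +o U) \<in> R \<and> rep (c +o U) \<in> c +o U"
      using that self rep unfolding R_def by blast
    show "a = rep (c +o U)" if "a \<in> R \<and> a \<in> c +o U" for a
      using that R_rep coset_eq_iff[OF U] by metis
  qed
  moreover have "disjoint_family_on (\<lambda>a. a +o U) R"
    unfolding disjoint_family_on_def
  proof (intro ballI impI, rule ccontr)
    fix a b assume ab: "a \<in> R" "b \<in> R" "a \<noteq> b" and "(a +o U) \<inter> (b +o U) \<noteq> {}"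
    then obtain d where "d \<in> a +o U" "d \<in> b +o U" by blast
    then have "a +o U = b +o U" using coset_eq_iff[OF U] by metis
    with ab show False using R_rep by metis
  qed
  moreover have "S = (\<Union>a\<in>R. a +o U)"
  proof
    show "S \<subseteq> (\<Union>a\<in>R. a +o U)"
    proof
      fix s assume "s \<in> S"
      moreover have "s \<in> rep (s +o U) +o U"
        using rep self coset_eq_iff[OF U] by metis
      ultimately show "s \<in> (\<Union>a\<in>R. a +o U)" unfolding R_def by blast
    qed
    show "(\<Union>a\<in>R. a +o U) \<subseteq> S" using sat R_sub by blast
  qed
  ultimately show ?thesis using R_sub by blast
qed

end

context lie_algebra
begin

text \<open>A hull is the intersection of the subalgebras containing the generators, so it suffices
  that both pairs lie in the same subalgebras; \<open>a\<close> is recovered by subtracting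
  \<open>c *s x\<close>.\<close>

lemma generated_pair_add_scale: "generated {x, a + c *s x} = generated {x, a}"
proof -
  have "x \<in> H \<and> a + c *s x \<in> H \<longleftrightarrow> x \<in> H \<and> a \<in> H" if "subalgebra H" for H
  proof -
    have H: "subspace H" using that by (simp add: subalgebra_def)
    have "a \<in> H" if "x \<in> H" "a + c *s x \<in> H"
      using subspace_diff[OF H that(2) subspace_scale[OF H that(1)], of c] by simp
    then show ?thesis using subspace_add[OF H] subspace_scale[OF H] by blast
  qed
  then show ?thesis
    unfolding generated_def hull_def by (metis (no_types, lifting) insert_subset empty_subsetI)
qed

lemma solvabilizer_add_span:
  assumes "a \<in> solvabilizer x"
  shows "a +o span {x} \<subseteq> solvabilizer x"
  using assms
  by (auto simp: solvabilizer_def elt_set_plus_def span_singleton generated_pair_add_scale)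

end

theorem lemma3p18:
  fixes scale :: "'f::field \<Rightarrow> 'l::ab_group_add \<Rightarrow> 'l"
    and bracket :: "'l \<Rightarrow> 'l \<Rightarrow> 'l"
    and x :: 'l
  assumes "fin_dim_lie_algebra scale bracket"
  shows "let sol = lie_algebra.solvabilizer scale bracket x;
             Fx = module.span scale {x}
         in (\<forall>a\<in>sol. a +o Fx \<subseteq> sol) \<and>
            (\<exists>R. R \<subseteq> sol \<and>
              (\<forall>c. c +o Fx \<subseteq> sol \<longrightarrow> (\<exists>!a. a \<in> R \<and> a \<in> c +o Fx)) \<and>
              disjoint_family_on (\<lambda>a. a +o Fx) R \<and>
              sol = (\<Union>a\<in>R. a +o Fx))"
proof -
  interpret fin_dim_lie_algebra scale bracket by (fact assms)
  show ?thesis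
    unfolding Let_def
    \<comment> \<open>\<open>solvabilizer_add_span\<close> serves twice: as the first conjunct and
      as the saturation hypothesis for the decomposition.\<close>
    by (intro conjI ballI solvabilizer_add_span
        saturated_disjoint_union_of_cosets[OF subspace_span solvabilizer_add_span])
qed

end
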